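(* Let $p$ be a mixture-of-Gaussians density on $\mathcal{X}=\mathbb{R}^D$, and consider the associated gradient system $$\frac{d\boldsymbol{x}}{dt}=R(\boldsymbol{x})^{-1}\nabla\ln p(\boldsymbol{x})=-R(\boldsymbol{x})^{-1}\sum_{k=1}^K\omega_k(\boldsymbol{x})\boldsymbol{\Sigma}_k^{-1}(\boldsymbol{x}-\boldsymbol{\mu}_k),$$ where $R(\cdot)$ is a Riemannian metric on $\mathcal{X}$. Suppose that $R(\cdot)$ has a finite condition number, i.e. $\sup_{\boldsymbol{x}\in\mathcal{X}}\kappa(R(\boldsymbol{x}))<\infty$. Let $\mathcal{M}$ with $\mathrm{Range}(\mathcal{M})\subseteq\mathcal{X}$ be a randomized algorithm that is $(\epsilon,\delta)$-differentially private. Then the dynamical processing by this system applied to $\mathcal{M}$ is $(\epsilon,\delta)$-differentially private, i.e. the solution trajectory $\boldsymbol{x}(t)$ of the system whose initial condition $\boldsymbol{x}(0)$ is the output of $\mathcal{M}$ is $(\epsilon,\delta)$-differentially private (for every $t\in\mathbb{R}$).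
   Context: The mixture-of-Gaussians density is $p(\boldsymbol{x})=\sum_{k=1}^K\pi_k g_k(\boldsymbol{x})$ with $g_k(\boldsymbol{x})=(2\pi)^{-D/2}|\boldsymbol{\Sigma}_k|^{-1/2}e^{-\frac12(\boldsymbol{x}-\boldsymbol{\mu}_k)^T\boldsymbol{\Sigma}_k^{-1}(\boldsymbol{x}-\boldsymbol{\mu}_k)}$, where $\boldsymbol{\mu}_k\in\mathbb{R}^D$ and $\boldsymbol{\Sigma}_k\in\mathbb{R}^{D\times D}$ are the mean and the (positive definite) covariance of the $k$-th normal distribution, and $\pi_k>0$ is the probability of belonging to the $k$-th cluster, $\sum_k\pi_k=1$. The weights are $\omega_k(\boldsymbol{x})=\pi_k g_k(\boldsymbol{x})/\sum_{l=1}^K\pi_l g_l(\boldsymbol{x})>0$. A Riemannian metric $R$ on $\mathcal{X}$ assigns to each $\boldsymbol{x}\in\mathcal{X}$ a positive definite symmetric matrix $R(\boldsymbol{x})\in\mathbb{R}^{D\times D}$; $\kappa(\cdot)$ denotes the spectral condition number (ratio of largest to smallest eigenvalue). Standing assumptions: $f=-\ln p$ is a Morse function (nonsingular Hessian at every point where $\nabla f=0$), and the solution trajectory of the system is defined for all $t\in\mathbb{R}$ for every initial condition in $\mathcal{X}$. Differential privacy: a randomized mechanism $\mathcal{M}$ is $(\epsilon,\delta)$-differentially private if for any set $\mathcal{S}\subseteq\mathrm{Range}(\mathcal{M})$ of possible outputs and any two neighboring datasets $D_1,D_2$ (datasets that differ in exactly one data sample), $\Pr[\mathcal{M}(D_1)\in\mathcal{S}]\le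 e^{\epsilon}\Pr[\mathcal{M}(D_2)\in\mathcal{S}]+\delta$. *)

theory Defs
  imports "HOL-Probability.Probability"
begin

section \<open>Matrices\<close>

definition pos_def_sym :: "real^'n^'n \<Rightarrow> bool" where
  "pos_def_sym A \<longleftrightarrow> transpose A = A \<and> (\<forall>v. v \<noteq> 0 \<longrightarrow> v \<bullet> (A *v v) > 0)"

definition eigenvalues :: "real^'n^'n \<Rightarrow> real set" where
  "eigenvalues A = {l. \<exists>v. v \<noteq> 0 \<and> A *v v = l *\<^sub>R v}"

definition condition_number :: "real^'n^'n \<Rightarrow> real" where
  "condition_number A = Max (eigenvalues A) / Min (eigenvalues A)"


section \<open>Gradients, Hessians and Morse functions\<close>

definition grad :: "(real^'n \<Rightarrow> real) \<Rightarrow> real^'n \<Rightarrow> real^'n" where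
  "grad f x = (THE g. GDERIV f x :> g)"

definition hessian :: "(real^'n \<Rightarrow> real) \<Rightarrow> real^'n \<Rightarrow> real^'n^'n" where
  "hessian f x = matrix (frechet_derivative (grad f) (at x))"

definition morse :: "(real^'n \<Rightarrow> real) \<Rightarrow> bool" where
  "morse f \<longleftrightarrow> (\<forall>x. grad f x = 0 \<longrightarrow> invertible (hessian f x))"


section \<open>Mixtures of Gaussians\<close>

definition gaussian :: "real^'n \<Rightarrow> real^'n^'n \<Rightarrow> real^'n \<Rightarrow> real" where
  "gaussian \<mu> \<Sigma> x =
     (2 * pi) powr (- real CARD('n) / 2) * det \<Sigma> powr (- 1 / 2)
       * exp (- (1 / 2) * ((x - \<mu>) \<bullet> (matrix_inv \<Sigma> *v (x - \<mu>))))"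

definition mog :: "nat \<Rightarrow> (nat \<Rightarrow> real) \<Rightarrow> (nat \<Rightarrow> real^'n) \<Rightarrow> (nat \<Rightarrow> real^'n^'n) \<Rightarrow> real^'n \<Rightarrow> real"
  where "mog K \<pi> \<mu> \<Sigma> x = (\<Sum>k=1..K. \<pi> k * gaussian (\<mu> k) (\<Sigma> k) x)"

definition mog_parameters ::
    "nat \<Rightarrow> (nat \<Rightarrow> real) \<Rightarrow> (nat \<Rightarrow> real^'n) \<Rightarrow> (nat \<Rightarrow> real^'n^'n) \<Rightarrow> bool" where
  "mog_parameters K \<pi> \<mu> \<Sigma> \<longleftrightarrow>
     (\<forall>k\<in>{1..K}. \<pi> k > 0 \<and> pos_def_sym (\<Sigma> k)) \<and> (\<Sum>k=1..K. \<pi> k) = 1"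

definition mog_weight ::
    "nat \<Rightarrow> (nat \<Rightarrow> real) \<Rightarrow> (nat \<Rightarrow> real^'n) \<Rightarrow> (nat \<Rightarrow> real^'n^'n) \<Rightarrow> nat \<Rightarrow> real^'n \<Rightarrow> real" where
  "mog_weight K \<pi> \<mu> \<Sigma> k x =
     \<pi> k * gaussian (\<mu> k) (\<Sigma> k) x / (\<Sum>l=1..K. \<pi> l * gaussian (\<mu> l) (\<Sigma> l) x)"


section \<open>Riemannian gradient systems\<close>

text \<open>A Riemannian metric varies smoothly with the point; continuous differentiability is all
  that is asked for here, so that every smooth metric qualifies.\<close>

definition riemannian_metric :: "(real^'n \<Rightarrow> real^'n^'n) \<Rightarrow> bool" where
  "riemannian_metric R \<longleftrightarrow>
     (\<forall>x. pos_def_sym (R x)) \<and>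
     (\<exists>R'. (\<forall>x. (R has_derivative blinfun_apply (R' x)) (at x)) \<and> continuous_on UNIV R')"

definition mog_field ::
    "(real^'n \<Rightarrow> real^'n^'n) \<Rightarrow> nat \<Rightarrow> (nat \<Rightarrow> real) \<Rightarrow> (nat \<Rightarrow> real^'n) \<Rightarrow> (nat \<Rightarrow> real^'n^'n)
       \<Rightarrow> real^'n \<Rightarrow> real^'n" where
  "mog_field R K \<pi> \<mu> \<Sigma> x = matrix_inv (R x) *v grad (\<lambda>y. ln (mog K \<pi> \<mu> \<Sigma> y)) x"

definition is_trajectory :: "('a::real_normed_vector \<Rightarrow> 'a) \<Rightarrow> (real \<Rightarrow> 'a) \<Rightarrow> bool" where
  "is_trajectory F x \<longleftrightarrow> (\<forall>t. (x has_vector_derivative F (x t)) (at t))"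


section \<open>Differential privacy\<close>

text \<open>Datasets are finite lists of samples; neighbours arise from each other by changing the
  sample at exactly one position.\<close>

definition neighboring :: "'s list \<Rightarrow> 's list \<Rightarrow> bool" where
  "neighboring D1 D2 \<longleftrightarrow>
     length D1 = length D2 \<and> card {i. i < length D1 \<and> D1 ! i \<noteq> D2 ! i} = 1"

text \<open>The probability space \<open>P\<close> carries the internal randomness of the algorithm: on dataset
  \<open>D\<close> it returns the random variable \<open>M D\<close>.\<close>

definition randomized_mechanism ::
    "'w measure \<Rightarrow> ('s list \<Rightarrow> 'w \<Rightarrow> 'a::topological_space) \<Rightarrow> bool" where
  "randomized_mechanism P M \<longleftrightarrow> prob_space P \<and> (\<forall>D. M D \<in> borel_measurable P)"

definition mechanism_range :: "'w measure \<Rightarrow> ('s list \<Rightarrow> 'w \<Rightarrow> 'a) \<Rightarrow> 'a set" where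
  "mechanism_range P M = (\<Union>D. M D ` space P)"

text \<open>The sets of outputs to which probabilities are assigned are the (relatively) Borel subsets of
  the range.\<close>

definition differentially_private ::
    "'w measure \<Rightarrow> ('s list \<Rightarrow> 'w \<Rightarrow> 'a::topological_space) \<Rightarrow> real \<Rightarrow> real \<Rightarrow> bool" where
  "differentially_private P M \<epsilon> \<delta> \<longleftrightarrow>
     randomized_mechanism P M \<and>
     (\<forall>D1 D2. neighboring D1 D2 \<longrightarrow>
        (\<forall>S \<in> sets (restrict_space borel (mechanism_range P M)).
           measure P {w \<in> space P. M D1 w \<in> S}
             \<le> exp \<epsilon> * measure P {w \<in> space P. M D2 w \<in> S} + \<delta>))"


section \<open>The explicit form of the vector field\<close>

lemma pos_def_sym_invertible:
  assumes "pos_def_sym (A :: real^'n^'n)"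
  shows "invertible A"
proof -
  have "\<forall>x. A *v x = 0 \<longrightarrow> x = 0"
    using assms unfolding pos_def_sym_def by (metis inner_zero_right less_irrefl)
  then show ?thesis
    using invertible_left_inverse matrix_left_invertible_ker by blast
qed

lemma pos_def_sym_det:
  assumes "pos_def_sym (A :: real^'n^'n)"
  shows "det A \<noteq> 0"
  using pos_def_sym_invertible[OF assms] invertible_det_nz by blast

lemma pos_def_sym_inv_sym:
  assumes "pos_def_sym (A :: real^'n^'n)"
  shows "v \<bullet> (matrix_inv A *v w) = (matrix_inv A *v v) \<bullet> w"
proof -
  have inv: "A ** matrix_inv A = mat 1"
    using someI_ex[OF pos_def_sym_invertible[OF assms, unfolded invertible_def]]
    by (simp add: matrix_inv_def)
  have r: "A *v (matrix_inv A *v u) = u" for u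
    by (simp add: matrix_vector_mul_assoc inv)
  have s: "a \<bullet> (A *v b) = (A *v a) \<bullet> b" for a b
    using assms unfolding pos_def_sym_def by (metis dot_lmul_matrix vector_transpose_matrix)
  show ?thesis using s[of "matrix_inv A *v v" "matrix_inv A *v w"] by (simp add: r)
qed

lemma gderiv_unique:
  fixes f :: "real^'n \<Rightarrow> real"
  assumes "GDERIV f x :> a" shows "grad f x = a"
  unfolding grad_def
proof (rule the_equality)
  show "GDERIV f x :> a" by fact
  fix b assume "GDERIV f x :> b"
  then have "(\<lambda>h. h \<bullet> b) = (\<lambda>h. h \<bullet> a)"
    using assms unfolding gderiv_def by (rule has_derivative_unique)
  then show "b = a" by (metis vector_eq_ldot)
qed

lemma gaussian_gderiv:
  fixes \<Sigma> :: "real^'n^'n"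
  assumes "pos_def_sym \<Sigma>"
  shows "GDERIV (gaussian \<mu> \<Sigma>) x :> - gaussian \<mu> \<Sigma> x *\<^sub>R (matrix_inv \<Sigma> *v (x - \<mu>))"
proof -
  define A where "A = matrix_inv \<Sigma>"
  define c where "c = (2 * pi) powr (- real CARD('n) / 2) * det \<Sigma> powr (- 1 / 2)"
  define q where "q = (\<lambda>y. - (1 / 2) * ((y - \<mu>) \<bullet> (A *v (y - \<mu>))))"
  have sub: "((\<lambda>y. y - \<mu>) has_derivative (\<lambda>h. h)) (at x)"
    by (auto intro!: derivative_eq_intros)
  have A: "((\<lambda>y. A *v (y - \<mu>)) has_derivative (\<lambda>h. A *v h)) (at x)"
    by (rule bounded_linear.has_derivative[OF matrix_vector_mul_bounded_linear sub])
  have "(q has_derivative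
      (\<lambda>h. - (1 / 2) * ((x - \<mu>) \<bullet> (A *v h) + h \<bullet> (A *v (x - \<mu>))))) (at x)"
    unfolding q_def by (intro has_derivative_mult_right has_derivative_inner sub A)
  moreover have "(x - \<mu>) \<bullet> (A *v h) = h \<bullet> (A *v (x - \<mu>))" for h
    using pos_def_sym_inv_sym[OF assms] unfolding A_def by (metis inner_commute)
  ultimately have "GDERIV q x :> - (A *v (x - \<mu>))"
    unfolding gderiv_def by simp
  moreover have "DERIV (\<lambda>u. c * exp u) (q x) :> c * exp (q x)"
    by (auto intro!: derivative_eq_intros)
  ultimately have "GDERIV (\<lambda>y. c * exp (q y)) x :> (c * exp (q x)) *\<^sub>R - (A *v (x - \<mu>))"
    by (rule GDERIV_DERIV_compose)
  moreover have "gaussian \<mu> \<Sigma> = (\<lambda>y. c * exp (q y))"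
    unfolding gaussian_def c_def q_def A_def by auto
  ultimately show ?thesis
    by (simp add: A_def)
qed

lemma mog_pos:
  assumes "mog_parameters K \<pi> \<mu> \<Sigma>"
  shows "mog K \<pi> \<mu> \<Sigma> x > 0"
  unfolding mog_def
proof (rule sum_pos)
  show "{1..K} \<noteq> {}"
  proof
    assume "{1..K} = {}"
    with assms show False unfolding mog_parameters_def by simp
  qed
  show "0 < \<pi> k * gaussian (\<mu> k) (\<Sigma> k) x" if "k \<in> {1..K}" for k
  proof -
    have "\<pi> k > 0" "det (\<Sigma> k) \<noteq> 0"
      using that assms pos_def_sym_det unfolding mog_parameters_def by blast+
    then show ?thesis unfolding gaussian_def by (intro mult_pos_pos) auto
  qed
qed simp

lemma mog_field_eq:
  assumes "mog_parameters K \<pi> \<mu> \<Sigma>"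
  shows "mog_field R K \<pi> \<mu> \<Sigma> x =
    - (matrix_inv (R x) *v
        (\<Sum>k=1..K. mog_weight K \<pi> \<mu> \<Sigma> k x *\<^sub>R (matrix_inv (\<Sigma> k) *v (x - \<mu> k))))"
proof -
  define p where "p = mog K \<pi> \<mu> \<Sigma>"
  define G where "G = (\<lambda>k. matrix_inv (\<Sigma> k) *v (x - \<mu> k))"
  have ppos: "p x > 0" unfolding p_def by (rule mog_pos[OF assms])
  have g: "GDERIV (gaussian (\<mu> k) (\<Sigma> k)) x :> - gaussian (\<mu> k) (\<Sigma> k) x *\<^sub>R G k"
    if "k \<in> {1..K}" for k
    using gaussian_gderiv that assms unfolding mog_parameters_def G_def by blast
  have "GDERIV p x :> (\<Sum>k=1..K. \<pi> k *\<^sub>R (- gaussian (\<mu> k) (\<Sigma> k) x *\<^sub>R G k))"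
    unfolding p_def mog_def gderiv_def inner_sum_right inner_scaleR_right
    using g by (intro has_derivative_sum has_derivative_mult_right) (auto simp: gderiv_def)
  moreover have "DERIV ln (p x) :> inverse (p x)"
    using ppos by (rule DERIV_ln)
  ultimately have "GDERIV (\<lambda>y. ln (p y)) x :>
      inverse (p x) *\<^sub>R (\<Sum>k=1..K. \<pi> k *\<^sub>R (- gaussian (\<mu> k) (\<Sigma> k) x *\<^sub>R G k))"
    by (rule GDERIV_DERIV_compose)
  then have "grad (\<lambda>y. ln (p y)) x =
      inverse (p x) *\<^sub>R (\<Sum>k=1..K. \<pi> k *\<^sub>R (- gaussian (\<mu> k) (\<Sigma> k) x *\<^sub>R G k))"
    by (rule gderiv_unique)
  also have "\<dots> = - (\<Sum>k=1..K. mog_weight K \<pi> \<mu> \<Sigma> k x *\<^sub>R G k)"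
    unfolding mog_weight_def p_def
    by (simp add: mog_def scaleR_sum_right sum_negf divide_inverse mult_ac)
  finally show ?thesis
    unfolding mog_field_def p_def G_def
    by (metis (no_types) matrix_vector_mult_scaleR scaleR_minus1_left)
qed

end

theory Submission
  imports Defs
begin

text \<open>The vector field is Lipschitz on every ball, so by a Gronwall estimate trajectories are unique
  and depend continuously on the initial value. Hence \<open>x(t) = \<phi> (x(0))\<close> for a continuous, hence Borel
  measurable, time-\<open>t\<close> map \<open>\<phi>\<close>, and differential privacy is preserved under measurable
  post-processing.\<close>

section \<open>Functions that are Lipschitz on balls\<close>

text \<open>In finite dimension this is local Lipschitz continuity. Phrasing it with balls supplies
  a single constant on any bounded region, in particular around a compact piece of a
  trajectory.\<close>

definition ball_lipschitz :: "('a::real_normed_vector \<Rightarrow> 'b::real_normed_vector) \<Rightarrow> bool" where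
  "ball_lipschitz f \<longleftrightarrow> (\<forall>r. \<exists>L. L-lipschitz_on (cball 0 r) f)"

lemma ball_lipschitz_bounded:
  fixes f :: "'a::euclidean_space \<Rightarrow> 'b::real_normed_vector"
  assumes "ball_lipschitz f"
  obtains B where "B > 0" "\<And>x. norm x \<le> r \<Longrightarrow> norm (f x) \<le> B"
proof -
  obtain L where "L-lipschitz_on (cball 0 r) f"
    using assms unfolding ball_lipschitz_def by blast
  then have "continuous_on (cball 0 r) f"
    by (rule lipschitz_on_continuous_on)
  then have "bounded (f ` cball 0 r)"
    by (intro compact_imp_bounded compact_continuous_image) auto
  then show thesis
    using that by (auto simp: bounded_pos)
qed

section \<open>Algebra of functions that are Lipschitz on balls\<close>

lemma ball_lipschitz_const: "ball_lipschitz (\<lambda>x. c)"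
  unfolding ball_lipschitz_def using lipschitz_on_constant by blast

lemma ball_lipschitz_id: "ball_lipschitz (\<lambda>x. x)"
  unfolding ball_lipschitz_def using lipschitz_on_id by blast

lemma ball_lipschitz_add:
  "ball_lipschitz f \<Longrightarrow> ball_lipschitz g \<Longrightarrow> ball_lipschitz (\<lambda>x. f x + g x)"
  unfolding ball_lipschitz_def using lipschitz_on_add by metis

lemma ball_lipschitz_minus:
  "ball_lipschitz f \<Longrightarrow> ball_lipschitz (\<lambda>x. - f x)"
  unfolding ball_lipschitz_def by simp

lemma ball_lipschitz_diff:
  "ball_lipschitz f \<Longrightarrow> ball_lipschitz g \<Longrightarrow> ball_lipschitz (\<lambda>x. f x - g x)"
  unfolding ball_lipschitz_def using lipschitz_on_diff by metis

lemma ball_lipschitz_sum: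
  assumes "\<And>i. i \<in> I \<Longrightarrow> ball_lipschitz (f i)"
  shows "ball_lipschitz (\<lambda>x. \<Sum>i\<in>I. f i x)"
  using assms
  by (induction I rule: infinite_finite_induct) (auto intro: ball_lipschitz_const ball_lipschitz_add)

text \<open>The usual product estimate: change one factor at a time, and bound the factor left fixed
  by compactness of the ball. Working in the locale covers products of reals, scalings and
  matrix-vector products at once.\<close>

lemma (in bounded_bilinear) ball_lipschitz_prod:
  fixes f :: "'d::euclidean_space \<Rightarrow> 'a" and g :: "'d \<Rightarrow> 'b"
  assumes f: "ball_lipschitz f" and g: "ball_lipschitz g"
  shows "ball_lipschitz (\<lambda>x. prod (f x) (g x))"
  unfolding ball_lipschitz_def
proof
  fix r
  obtain K where K: "K > 0" "\<And>a b. norm (prod a b) \<le> norm a * norm b * K"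
    using pos_bounded by blast
  obtain Lf Lg where L: "Lf-lipschitz_on (cball 0 r) f" "Lg-lipschitz_on (cball 0 r) g"
    using f g unfolding ball_lipschitz_def by blast
  obtain Bf where Bf: "Bf > 0" "\<And>x. norm x \<le> r \<Longrightarrow> norm (f x) \<le> Bf"
    using ball_lipschitz_bounded[OF f] by blast
  obtain Bg where Bg: "Bg > 0" "\<And>x. norm x \<le> r \<Longrightarrow> norm (g x) \<le> Bg"
    using ball_lipschitz_bounded[OF g] by blast
  have L0: "Lf \<ge> 0" "Lg \<ge> 0" using L lipschitz_on_nonneg by blast+
  have "norm (prod (f x) (g x) - prod (f y) (g y)) \<le> (Lf * Bg * K + Bf * Lg * K) * norm (x - y)"
    if "norm x \<le> r" "norm y \<le> r" for x y
  proof -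
    have "prod (f x) (g x) - prod (f y) (g y) = prod (f x - f y) (g x) + prod (f y) (g x - g y)"
      by (simp add: diff_left diff_right)
    also have "norm \<dots> \<le> norm (f x - f y) * norm (g x) * K + norm (f y) * norm (g x - g y) * K"
      by (intro norm_triangle_mono K)
    also have "\<dots> \<le> (Lf * norm (x - y)) * Bg * K + Bf * (Lg * norm (x - y)) * K"
      using L that Bf Bg K(1) L0
      by (intro add_mono mult_mono mult_nonneg_nonneg) (auto dest: lipschitz_on_normD)
    finally show ?thesis by (simp add: algebra_simps)
  qed
  then have "(Lf * Bg * K + Bf * Lg * K)-lipschitz_on (cball 0 r) (\<lambda>x. prod (f x) (g x))"
    using K(1) L0 Bf(1) Bg(1) by (auto intro!: lipschitz_onI simp: dist_norm)
  then show "\<exists>L. L-lipschitz_on (cball 0 r) (\<lambda>x. prod (f x) (g x))" ..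
qed

lemma bounded_bilinear_matrix_vector_mult:
  "bounded_bilinear ((*v) :: real^'n^'m \<Rightarrow> real^'n \<Rightarrow> real^'m)"
proof -
  have "bilinear ((*v) :: real^'n^'m \<Rightarrow> real^'n \<Rightarrow> real^'m)"
    unfolding bilinear_def
    by (auto intro!: linearI simp: matrix_vector_mult_add_rdistrib matrix_vector_right_distrib
        matrix_vector_mult_scaleR scaleR_matrix_vector_assoc)
  then show ?thesis by (simp add: bilinear_conv_bounded_bilinear)
qed

text \<open>The continuous derivative is bounded on the compact ball, and the ball is convex, so the
  mean value inequality applies with that bound.\<close>

lemma C1_imp_ball_lipschitz:
  fixes f :: "'a::euclidean_space \<Rightarrow> 'b::real_normed_vector"
  assumes d: "\<And>x. (f has_derivative blinfun_apply (f' x)) (at x)"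
    and c: "continuous_on UNIV f'"
  shows "ball_lipschitz f"
  unfolding ball_lipschitz_def
proof
  fix r
  have "bounded (f' ` cball 0 r)"
    using c by (intro compact_imp_bounded compact_continuous_image)
      (auto intro: continuous_on_subset)
  then obtain B where B: "B > 0" "\<And>x. x \<in> cball 0 r \<Longrightarrow> norm (f' x) \<le> B"
    by (auto simp: bounded_pos)
  have "norm (f x - f y) \<le> B * norm (x - y)" if "x \<in> cball 0 r" "y \<in> cball 0 r" for x y
    using that
    by (intro differentiable_bound[OF convex_cball[of 0 r] has_derivative_at_withinI[OF d]])
      (auto intro!: B simp: norm_blinfun.rep_eq[symmetric])
  then have "B-lipschitz_on (cball 0 r) f"
    using B(1) by (auto intro!: lipschitz_onI simp: dist_norm)
  then show "\<exists>L. L-lipschitz_on (cball 0 r) f" ..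
qed

section \<open>Linear equations with a positive definite coefficient matrix\<close>

text \<open>The quadratic form is continuous and positive on the compact product of the ball and the
  unit sphere, so its minimum \<open>c\<close> there is positive. Homogeneity in \<open>v\<close>
  extends the bound to all vectors.\<close>

lemma pos_def_uniform:
  fixes B :: "'a::euclidean_space \<Rightarrow> real^'n^'n"
  assumes B: "ball_lipschitz B"
    and pd: "\<And>x v. v \<noteq> 0 \<Longrightarrow> v \<bullet> (B x *v v) > 0"
  obtains c where "c > 0" "\<And>x v. norm x \<le> r \<Longrightarrow> c * norm v ^ 2 \<le> v \<bullet> (B x *v v)"
proof (cases "r \<ge> 0")
  case False
  \<comment> \<open>For negative \<open>r\<close> no point satisfies \<open>norm x \<le> r\<close>,
    so any positive constant will do.\<close>
  then show thesis using that[of 1] by (meson norm_ge_zero order_trans zero_less_one)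
next
  case True
  define S where "S = cball (0::'a) r \<times> sphere (0::real^'n) 1"
  obtain b :: "real^'n" where "b \<in> Basis" using nonempty_Basis by blast
  then have "(0, b) \<in> S" using True by (auto simp: S_def)
  then have ne: "S \<noteq> {}" by blast
  have "compact S" unfolding S_def by (intro compact_Times) auto
  obtain L where "L-lipschitz_on (cball 0 r) B"
    using B unfolding ball_lipschitz_def by blast
  then have "continuous_on (cball 0 r) B" by (rule lipschitz_on_continuous_on)
  then have "continuous_on S (\<lambda>z. B (fst z))"
    by (rule continuous_on_compose2) (auto simp: S_def intro: continuous_on_fst)
  then have "continuous_on S (\<lambda>z. snd z \<bullet> (B (fst z) *v snd z))"
    by (intro continuous_on_inner bounded_bilinear.continuous_on[OF bounded_bilinear_matrix_vector_mult]
        continuous_on_snd continuous_on_id)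
  from continuous_attains_inf[OF \<open>compact S\<close> ne this]
  obtain z where z: "z \<in> S"
    "\<And>w. w \<in> S \<Longrightarrow> snd z \<bullet> (B (fst z) *v snd z) \<le> snd w \<bullet> (B (fst w) *v snd w)"
    by blast
  define c where "c = snd z \<bullet> (B (fst z) *v snd z)"
  have "snd z \<noteq> 0" using z(1) by (auto simp: S_def)
  then have "c > 0" unfolding c_def by (rule pd)
  moreover have "c * norm v ^ 2 \<le> v \<bullet> (B x *v v)" if "norm x \<le> r" for x v
  proof (cases "v = 0")
    case False
    define u where "u = v /\<^sub>R norm v"
    have "(x, u) \<in> S" using that False by (auto simp: S_def u_def)
    from z(2)[OF this] have "c \<le> u \<bullet> (B x *v u)" by (simp add: c_def)
    then have "c * norm v ^ 2 \<le> (u \<bullet> (B x *v u)) * norm v ^ 2"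
      by (rule mult_right_mono) simp
    also have "\<dots> = v \<bullet> (B x *v v)"
      using False by (simp add: u_def matrix_vector_mult_scaleR power2_eq_square field_simps)
    finally show ?thesis .
  qed simp
  ultimately show thesis using that by blast
qed

text \<open>Regards \<open>F x\<close> as the solution of a linear system with coefficient matrix
  \<open>B x\<close>. Regularity of \<open>F\<close> then follows from that of the coefficients and
  the right-hand side, without differentiating a matrix inverse.\<close>

lemma ball_lipschitz_solution:
  fixes B :: "'a::euclidean_space \<Rightarrow> real^'n^'n" and F :: "'a \<Rightarrow> real^'n"
  assumes B: "ball_lipschitz B"
    and pd: "\<And>x v. v \<noteq> 0 \<Longrightarrow> v \<bullet> (B x *v v) > 0"
    and h: "ball_lipschitz (\<lambda>x. B x *v F x)"
  shows "ball_lipschitz F"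
  unfolding ball_lipschitz_def
proof
  fix r
  obtain c where c: "c > 0" "\<And>x v. norm x \<le> r \<Longrightarrow> c * norm v ^ 2 \<le> v \<bullet> (B x *v v)"
    using pos_def_uniform[OF B pd] by blast
  \<comment> \<open>Coercivity and Cauchy-Schwarz bound \<open>B x\<close> from below, which amounts
    to a bound on its inverse uniform over the ball.\<close>
  have inv: "c * norm v \<le> norm (B x *v v)" if "norm x \<le> r" for x v
  proof (cases "v = 0")
    case False
    have "c * norm v ^ 2 \<le> norm v * norm (B x *v v)"
      using c(2)[OF that] norm_cauchy_schwarz order_trans by blast
    then show ?thesis using False by (simp add: power2_eq_square)
  qed simp
  obtain K where K: "K > 0" "\<And>(A::real^'n^'n) (v::real^'n). norm (A *v v) \<le> norm A * norm v * K"
    using bounded_bilinear.pos_bounded[OF bounded_bilinear_matrix_vector_mult] by blast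
  obtain LB Lh where L: "LB-lipschitz_on (cball 0 r) B" "Lh-lipschitz_on (cball 0 r) (\<lambda>x. B x *v F x)"
    using B h unfolding ball_lipschitz_def by blast
  have L0: "LB \<ge> 0" "Lh \<ge> 0" using L lipschitz_on_nonneg by blast+
  obtain H where H: "H > 0" "\<And>x. norm x \<le> r \<Longrightarrow> norm (B x *v F x) \<le> H"
    using ball_lipschitz_bounded[OF h] by blast
  have FH: "norm (F x) \<le> H / c" if "norm x \<le> r" for x
    using inv[OF that, of "F x"] H(2)[OF that] c(1) by (simp add: field_simps)
  have "norm (F x - F y) \<le> ((Lh + LB * (H / c) * K) / c) * norm (x - y)"
    if xy: "norm x \<le> r" "norm y \<le> r" for x y
  proof -
    have "c * norm (F x - F y) \<le> norm (B x *v (F x - F y))" by (rule inv[OF xy(1)])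
    \<comment> \<open>Subtracting the systems at \<open>x\<close> and \<open>y\<close> leaves the
      difference of the right-hand sides and a term with \<open>B x - B y\<close>; the latter is
      controlled by the bound \<open>H / c\<close> on \<open>F y\<close>.\<close>
    also have "B x *v (F x - F y) = (B x *v F x - B y *v F y) - (B x - B y) *v F y"
      by (simp add: matrix_vector_mult_diff_distrib matrix_vector_mult_diff_rdistrib)
    also have "norm \<dots> \<le> norm (B x *v F x - B y *v F y) + norm (B x - B y) * norm (F y) * K"
      by (meson K(2) add_left_mono norm_triangle_ineq4 order_trans)
    also have "\<dots> \<le> Lh * norm (x - y) + (LB * norm (x - y)) * (H / c) * K"
      using L xy K(1) L0 c(1) H(1) FH[OF xy(2)] lipschitz_on_normD[OF L(1), of x y]
        lipschitz_on_normD[OF L(2), of x y]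
      by (intro add_mono mult_mono mult_nonneg_nonneg) auto
    finally show ?thesis using c(1) by (simp add: field_simps)
  qed
  then have "((Lh + LB * (H / c) * K) / c)-lipschitz_on (cball 0 r) F"
    using K(1) L0 c(1) H(1) by (auto intro!: lipschitz_onI simp: dist_norm)
  then show "\<exists>L. L-lipschitz_on (cball 0 r) F" ..
qed

section \<open>The vector field of a mixture of Gaussians\<close>

text \<open>The gradient formula contains the Gaussian itself, so differentiability already gives a
  continuous gradient, hence a C1 function.\<close>

lemma ball_lipschitz_gaussian:
  fixes \<Sigma> :: "real^'n^'n"
  assumes "pos_def_sym \<Sigma>"
  shows "ball_lipschitz (gaussian \<mu> \<Sigma>)"
proof (rule C1_imp_ball_lipschitz)
  let ?g = "\<lambda>x. - gaussian \<mu> \<Sigma> x *\<^sub>R (matrix_inv \<Sigma> *v (x - \<mu>))"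
  show d: "(gaussian \<mu> \<Sigma> has_derivative blinfun_apply (blinfun_inner_left (?g x))) (at x)" for x
    using gaussian_gderiv[OF assms, of \<mu> x] by (simp add: gderiv_def)
  have "continuous_on UNIV (gaussian \<mu> \<Sigma>)"
    using d by (auto intro!: continuous_at_imp_continuous_on has_derivative_continuous)
  then have "continuous_on UNIV ?g"
    by (intro continuous_on_scaleR continuous_on_minus
        bounded_linear.continuous_on[OF matrix_vector_mul_bounded_linear] continuous_intros)
  then show "continuous_on UNIV (\<lambda>x. blinfun_inner_left (?g x))"
    by (rule bounded_linear.continuous_on[OF bounded_linear_blinfun_inner_left])
qed

text \<open>Multiplying the field by \<open>?p x *\<^sub>R R x\<close> clears both the metric
  inverse and the common denominator of the weights. What remains is a sum of products of constants,
  Gaussians and affine maps, so the field solves a positive definite system with ball Lipschitz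
  data.\<close>

lemma ball_lipschitz_mog_field:
  fixes R :: "real^'n \<Rightarrow> real^'n^'n"
  assumes mixture: "mog_parameters K \<pi> \<mu> \<Sigma>" and metric: "riemannian_metric R"
  shows "ball_lipschitz (mog_field R K \<pi> \<mu> \<Sigma>)"
proof (rule ball_lipschitz_solution)
  let ?F = "mog_field R K \<pi> \<mu> \<Sigma>" and ?p = "mog K \<pi> \<mu> \<Sigma>"
  have g: "ball_lipschitz (gaussian (\<mu> k) (\<Sigma> k))" if "k \<in> {1..K}" for k
    using that mixture ball_lipschitz_gaussian unfolding mog_parameters_def by blast
  have pg: "ball_lipschitz (\<lambda>x. \<pi> k * gaussian (\<mu> k) (\<Sigma> k) x)" if "k \<in> {1..K}" for k
    using that
    by (intro bounded_bilinear.ball_lipschitz_prod[OF bounded_bilinear_mult] ball_lipschitz_const g)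
  obtain R' where "\<And>x. (R has_derivative blinfun_apply (R' x)) (at x)" "continuous_on UNIV R'"
    and pdR: "\<And>x. pos_def_sym (R x)"
    using metric unfolding riemannian_metric_def by blast
  then have "ball_lipschitz R" by (intro C1_imp_ball_lipschitz)
  moreover have "ball_lipschitz ?p"
    unfolding mog_def by (intro ball_lipschitz_sum pg)
  ultimately show "ball_lipschitz (\<lambda>x. ?p x *\<^sub>R R x)"
    by (intro bounded_bilinear.ball_lipschitz_prod[OF bounded_bilinear_scaleR])
  show "v \<bullet> ((?p x *\<^sub>R R x) *v v) > 0" if "v \<noteq> 0" for x v
    using mog_pos[OF mixture, of x] pdR[of x] that
    by (simp add: pos_def_sym_def flip: scaleR_matrix_vector_assoc)
  have "(?p x *\<^sub>R R x) *v ?F x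
      = - (\<Sum>k=1..K. (\<pi> k * gaussian (\<mu> k) (\<Sigma> k) x) *\<^sub>R (matrix_inv (\<Sigma> k) *v (x - \<mu> k)))" for x
  proof -
    have inv: "R x ** matrix_inv (R x) = mat 1"
      using someI_ex[OF pos_def_sym_invertible[OF pdR, unfolded invertible_def]]
      by (simp add: matrix_inv_def)
    have "R x *v ?F x
        = - (\<Sum>k=1..K. mog_weight K \<pi> \<mu> \<Sigma> k x *\<^sub>R (matrix_inv (\<Sigma> k) *v (x - \<mu> k)))"
      by (simp add: mog_field_eq[OF mixture] linear_neg[OF matrix_vector_mul_linear]
          matrix_vector_mul_assoc inv)
    moreover have "?p x * mog_weight K \<pi> \<mu> \<Sigma> k x = \<pi> k * gaussian (\<mu> k) (\<Sigma> k) x" for k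
      using mog_pos[OF mixture, of x] by (simp add: mog_weight_def mog_def)
    ultimately show ?thesis
      by (simp add: scaleR_sum_right flip: scaleR_matrix_vector_assoc)
  qed
  moreover have "ball_lipschitz (\<lambda>x. - (\<Sum>k=1..K. (\<pi> k * gaussian (\<mu> k) (\<Sigma> k) x)
      *\<^sub>R (matrix_inv (\<Sigma> k) *v (x - \<mu> k))))"
    by (intro ball_lipschitz_minus ball_lipschitz_sum ball_lipschitz_diff ball_lipschitz_const
        bounded_bilinear.ball_lipschitz_prod[OF bounded_bilinear_scaleR]
        bounded_bilinear.ball_lipschitz_prod[OF bounded_bilinear_matrix_vector_mult]
        ball_lipschitz_id pg)
  ultimately show "ball_lipschitz (\<lambda>x. (?p x *\<^sub>R R x) *v ?F x)" by simp
qed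

section \<open>Continuous dependence on the initial value\<close>

text \<open>The Lipschitz inequality is assumed only along the two trajectories up to time
  \<open>s\<close>, so a constant valid on a ball suffices as long as both stay inside it.\<close>

lemma gronwall_difference:
  fixes F :: "'a::real_inner \<Rightarrow> 'a"
  assumes y: "is_trajectory F y" and z: "is_trajectory F z" and "s \<ge> 0"
    and L: "\<And>\<tau>. 0 \<le> \<tau> \<Longrightarrow> \<tau> \<le> s \<Longrightarrow> norm (F (z \<tau>) - F (y \<tau>)) \<le> L * norm (z \<tau> - y \<tau>)"
  shows "norm (z s - y s) \<le> exp (L * s) * norm (z 0 - y 0)"
proof -
  define w where "w \<tau> = z \<tau> - y \<tau>" for \<tau>
  \<comment> \<open>The squared distance is differentiable even where the norm is not. The
    exponential is the integrating factor that makes \<open>u\<close> nonincreasing.\<close>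
  define u where "u \<tau> = exp (- 2 * L * \<tau>) * (w \<tau> \<bullet> w \<tau>)" for \<tau>
  have "u 0 \<ge> u s"
  proof (rule DERIV_nonpos_imp_nonincreasing[OF \<open>s \<ge> 0\<close>])
    fix \<tau> assume \<tau>: "0 \<le> \<tau>" "\<tau> \<le> s"
    define d where "d = F (z \<tau>) - F (y \<tau>)"
    have "(w has_vector_derivative d) (at \<tau>)"
      using y z unfolding is_trajectory_def w_def d_def
      by (auto intro!: derivative_intros)
    then have "((\<lambda>\<tau>. w \<tau> \<bullet> w \<tau>) has_real_derivative (2 * (w \<tau> \<bullet> d))) (at \<tau>)"
      unfolding has_vector_derivative_def has_field_derivative_def
      by (auto intro!: derivative_eq_intros simp: inner_commute fun_eq_iff)
    then have "(u has_real_derivative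
        exp (- 2 * L * \<tau>) * (2 * (w \<tau> \<bullet> d) - 2 * L * (w \<tau> \<bullet> w \<tau>))) (at \<tau>)"
      unfolding u_def by (auto intro!: derivative_eq_intros simp: algebra_simps)
    moreover have "w \<tau> \<bullet> d \<le> L * (w \<tau> \<bullet> w \<tau>)"
    proof -
      have "w \<tau> \<bullet> d \<le> norm (w \<tau>) * norm d" by (rule norm_cauchy_schwarz)
      also have "\<dots> \<le> norm (w \<tau>) * (L * norm (w \<tau>))"
        using L[OF \<tau>] by (intro mult_left_mono) (auto simp: w_def d_def)
      finally show ?thesis by (simp add: dot_square_norm power2_eq_square mult_ac)
    qed
    ultimately show "\<exists>v. (u has_real_derivative v) (at \<tau>) \<and> v \<le> 0"
      by (intro exI conjI) (auto simp: mult_nonneg_nonpos)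
  qed
  then have "norm (w s) ^ 2 \<le> exp (2 * (L * s)) * norm (w 0) ^ 2"
    by (simp add: u_def dot_square_norm mult.assoc exp_minus field_simps)
  also have "\<dots> = (exp (L * s) * norm (w 0)) ^ 2"
    by (simp only: power_mult_distrib exp_double)
  finally show ?thesis by (simp add: w_def power2_le_iff_abs_le)
qed

lemma trajectory_continuous_on:
  "is_trajectory F y \<Longrightarrow> continuous_on S y"
  unfolding is_trajectory_def
  by (meson continuous_at_imp_continuous_on has_vector_derivative_continuous)

text \<open>Continuation argument: the Gronwall bound is available only while \<open>z\<close> stays
  within distance 1 of \<open>y\<close>, and the bound itself prevents \<open>z\<close> from
  reaching that distance.\<close>

lemma trajectory_dependence_forward:
  fixes F :: "'a::euclidean_space \<Rightarrow> 'a"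
  assumes F: "ball_lipschitz F" and y: "is_trajectory F y" and "t \<ge> 0" "e > 0"
  shows "\<exists>d>0. \<forall>z. is_trajectory F z \<longrightarrow> norm (z 0 - y 0) < d \<longrightarrow> norm (z t - y t) < e"
proof -
  have "bounded (y ` {0..t})"
    by (intro compact_imp_bounded compact_continuous_image trajectory_continuous_on[OF y]) auto
  then obtain r where "\<forall>a\<in>y ` {0..t}. norm a \<le> r"
    unfolding bounded_iff by blast
  then have r: "norm (y s) \<le> r" if "0 \<le> s" "s \<le> t" for s
    using that by simp
  \<comment> \<open>The extra 1 in the radius leaves room for every point within distance 1 of the
    trajectory \<open>y\<close>.\<close>
  obtain L where L: "L-lipschitz_on (cball 0 (r + 1)) F"
    using F unfolding ball_lipschitz_def by blast
  have L0: "L \<ge> 0" using L lipschitz_on_nonneg by blast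
  \<comment> \<open>Gronwall growth up to time \<open>t\<close> is at most
    \<open>exp (L * t)\<close>. The 1 in the minimum keeps \<open>z\<close> near \<open>y\<close>,
    the \<open>e\<close> gives the required accuracy.\<close>
  define d where "d = min 1 e / exp (L * t)"
  have "norm (z t - y t) < e" if z: "is_trajectory F z" and zd: "norm (z 0 - y 0) < d" for z
  proof -
    \<comment> \<open>A weak bound by 1 up to time \<open>s\<close> improves to a strict one at
      \<open>s\<close>; this gain closes the continuation argument.\<close>
    have est: "norm (z s - y s) < min 1 e" if "0 \<le> s" "s \<le> t"
      and near: "\<And>\<tau>. 0 \<le> \<tau> \<Longrightarrow> \<tau> \<le> s \<Longrightarrow> norm (z \<tau> - y \<tau>) \<le> 1" for s
    proof -
      have "norm (F (z \<tau>) - F (y \<tau>)) \<le> L * norm (z \<tau> - y \<tau>)" if "0 \<le> \<tau>" "\<tau> \<le> s" for \<tau>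
        using r[of \<tau>] near[of \<tau>] that \<open>s \<le> t\<close> norm_triangle_sub[of "z \<tau>" "y \<tau>"]
        by (intro lipschitz_on_normD[OF L]) auto
      then have "norm (z s - y s) \<le> exp (L * s) * norm (z 0 - y 0)"
        using gronwall_difference[OF y z \<open>0 \<le> s\<close>] by blast
      also have "\<dots> \<le> exp (L * t) * norm (z 0 - y 0)"
        using L0 \<open>s \<le> t\<close> by (intro mult_right_mono) (auto intro: mult_left_mono)
      also have "\<dots> < min 1 e"
        using zd by (simp add: d_def field_simps)
      finally show ?thesis .
    qed
    have "norm (z s - y s) < 1" if s: "0 \<le> s" "s \<le> t" for s
    proof (rule ccontr)
      assume far: "\<not> norm (z s - y s) < 1"
      define f where "f \<tau> = norm (z \<tau> - y \<tau>)" for \<tau>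
      have f: "continuous_on S f" for S
        unfolding f_def
        by (intro continuous_intros trajectory_continuous_on[OF y] trajectory_continuous_on[OF z])
      have f0: "f 0 < 1"
      proof -
        have "d \<le> 1" using L0 \<open>t \<ge> 0\<close> by (auto simp: d_def divide_le_eq min_le_iff_disj)
        then show ?thesis using zd by (simp add: f_def)
      qed
      \<comment> \<open>If \<open>z\<close> ever reached distance 1, compactness of \<open>T\<close>
        would give a first time \<open>m\<close> at which it does.\<close>
      define T where "T = {0..t} \<inter> {\<tau>. 1 \<le> f \<tau>}"
      have "compact T"
        unfolding T_def
        by (rule compact_Int_closed[OF compact_Icc closed_Collect_le[OF continuous_on_const f]])
      moreover have "T \<noteq> {}" using s far by (auto simp: T_def f_def)
      ultimately obtain m where m: "m \<in> T" "\<And>\<tau>. \<tau> \<in> T \<Longrightarrow> m \<le> \<tau>"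
        using compact_attains_inf[of T] by metis
      have lt: "f \<tau> < 1" if "0 \<le> \<tau>" "\<tau> < m" for \<tau>
      proof (rule ccontr)
        assume "\<not> f \<tau> < 1"
        then have "\<tau> \<in> T" using m(1) that by (simp add: T_def)
        then show False using m(2)[of \<tau>] that by simp
      qed
      \<comment> \<open>A value above 1 at \<open>m\<close> would, by the intermediate value
        theorem, force the value 1 at an earlier time, against minimality of \<open>m\<close>. Hence
        \<open>est\<close> applies on all of \<open>[0, m]\<close>.\<close>
      have "f m \<le> 1"
      proof (rule ccontr)
        assume "\<not> f m \<le> 1"
        moreover have "0 \<le> m" using m(1) by (auto simp: T_def)
        ultimately obtain \<tau> where "0 \<le> \<tau>" "\<tau> \<le> m" "f \<tau> = 1"
          using IVT'[of f 0 1 m, OF _ _ _ f] f0 by force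
        then show False
          using lt[of \<tau>] \<open>\<not> f m \<le> 1\<close> by (cases "\<tau> = m") simp_all
      qed
      then have "f \<tau> \<le> 1" if "0 \<le> \<tau>" "\<tau> \<le> m" for \<tau>
        using lt[of \<tau>] that by (cases "\<tau> = m") simp_all
      then have "f m < min 1 e"
        using m(1) unfolding f_def by (intro est) (simp_all add: T_def)
      then show False using m(1) by (auto simp: T_def)
    qed
    then have "norm (z t - y t) < min 1 e"
      using \<open>t \<ge> 0\<close> by (intro est) (simp_all add: less_imp_le)
    then show ?thesis by simp
  qed
  moreover have "d > 0" using \<open>e > 0\<close> by (simp add: d_def)
  ultimately show ?thesis by blast
qed

section \<open>Negative times, uniqueness and the time-\<open>t\<close> map\<close>

lemma trajectory_reverse:
  assumes "is_trajectory F y"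
  shows "is_trajectory (\<lambda>a. - F a) (\<lambda>t. y (- t))"
  unfolding is_trajectory_def
proof
  fix t
  have "(y has_vector_derivative F (y (- t))) (at (- t))"
    using assms unfolding is_trajectory_def by blast
  moreover have "(uminus has_vector_derivative -1) (at t)"
    by (auto intro!: derivative_eq_intros)
  ultimately have "(y \<circ> uminus has_vector_derivative -1 *\<^sub>R F (y (- t))) (at t)"
    by (intro vector_diff_chain_at) auto
  then show "((\<lambda>t. y (- t)) has_vector_derivative - F (y (- t))) (at t)"
    by (simp add: o_def)
qed

text \<open>For negative \<open>t\<close>, time reversal gives a forward problem for the field
  \<open>- F\<close>, which is Lipschitz on balls as well.\<close>

lemma trajectory_dependence:
  fixes F :: "'a::euclidean_space \<Rightarrow> 'a"
  assumes F: "ball_lipschitz F" and y: "is_trajectory F y" and "e > 0"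
  shows "\<exists>d>0. \<forall>z. is_trajectory F z \<longrightarrow> norm (z 0 - y 0) < d \<longrightarrow> norm (z t - y t) < e"
proof (cases "t \<ge> 0")
  case True
  then show ?thesis using trajectory_dependence_forward[OF F y _ \<open>e > 0\<close>] by blast
next
  case False
  then obtain d where d: "d > 0" "\<And>z. is_trajectory (\<lambda>a. - F a) z \<Longrightarrow> norm (z 0 - y 0) < d \<Longrightarrow>
      norm (z (- t) - y t) < e"
    using trajectory_dependence_forward[OF ball_lipschitz_minus[OF F] trajectory_reverse[OF y], of "- t" e]
      \<open>e > 0\<close> by auto
  show ?thesis
    using d(1) d(2)[OF trajectory_reverse] by auto
qed

text \<open>With equal initial values the closeness condition holds for every \<open>d > 0\<close>,
  so the distance at time \<open>t\<close> is below every positive \<open>e\<close>.\<close>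

lemma trajectory_unique:
  fixes F :: "'a::euclidean_space \<Rightarrow> 'a"
  assumes F: "ball_lipschitz F" and y: "is_trajectory F y" and z: "is_trajectory F z"
    and "z 0 = y 0"
  shows "z = y"
proof
  fix t
  have "norm (z t - y t) < e" if "e > 0" for e
    using trajectory_dependence[OF F y that, of t] z \<open>z 0 = y 0\<close> by auto
  then show "z t = y t"
    by (metis eq_iff_diff_eq_0 less_irrefl zero_less_norm_iff)
qed

text \<open>Choose one trajectory per initial value and evaluate it at \<open>t\<close>. Uniqueness
  makes the result independent of the choice, and continuous dependence makes it continuous.\<close>

lemma continuous_time_map:
  fixes F :: "'a::euclidean_space \<Rightarrow> 'a"
  assumes F: "ball_lipschitz F"
    and complete: "\<And>x0. \<exists>y. is_trajectory F y \<and> y 0 = x0"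
  obtains \<phi> where "continuous_on UNIV \<phi>" "\<And>y. is_trajectory F y \<Longrightarrow> y t = \<phi> (y 0)"
proof -
  obtain Y where Y: "\<And>x0. is_trajectory F (Y x0)" "\<And>x0. Y x0 0 = x0"
    using complete by metis
  have "continuous_on UNIV (\<lambda>x0. Y x0 t)"
    unfolding continuous_on_iff dist_norm
  proof (intro ballI allI impI)
    fix e :: real and x0 assume "e > 0"
    then show "\<exists>d>0. \<forall>x'\<in>UNIV. norm (x' - x0) < d \<longrightarrow> norm (Y x' t - Y x0 t) < e"
      using trajectory_dependence[OF F Y(1)[of x0] \<open>e > 0\<close>, of t] Y by metis
  qed
  moreover have "y t = Y (y 0) t" if "is_trajectory F y" for y
    using trajectory_unique[OF F Y(1)[of "y 0"] that] Y(2) by simp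
  ultimately show thesis using that by blast
qed

section \<open>Post-processing\<close>

text \<open>An event for the processed output is the event that the original output lies in a
  preimage under \<open>\<phi>\<close>, so the privacy inequality for \<open>M\<close> carries over
  with the same parameters.\<close>

lemma differentially_private_postprocess:
  fixes M :: "'s list \<Rightarrow> 'w \<Rightarrow> 'a::topological_space" and N :: "'s list \<Rightarrow> 'w \<Rightarrow> 'b::topological_space"
  assumes dp: "differentially_private P M \<epsilon> \<delta>"
    and \<phi>: "\<phi> \<in> borel_measurable borel"
    and N: "\<And>D w. w \<in> space P \<Longrightarrow> N D w = \<phi> (M D w)"
  shows "differentially_private P N \<epsilon> \<delta>"
  unfolding differentially_private_def
proof (intro conjI allI impI ballI)
  have meas: "M D \<in> borel_measurable P" for D
    using dp unfolding differentially_private_def randomized_mechanism_def by blast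
  have "N D \<in> borel_measurable P" for D
    using measurable_compose[OF meas \<phi>] by (simp add: N cong: measurable_cong)
  then show "randomized_mechanism P N"
    using dp unfolding differentially_private_def randomized_mechanism_def by blast
  fix D1 D2 :: "'s list" and S
  assume nb: "neighboring D1 D2"
    and S: "S \<in> sets (restrict_space borel (mechanism_range P N))"
  obtain B where B: "B \<in> sets borel" "S = mechanism_range P N \<inter> B"
    using S by (auto simp: sets_restrict_space)
  \<comment> \<open>The preimage is cut down to the range of \<open>M\<close>, since privacy of
    \<open>M\<close> speaks of relatively Borel subsets of it. The event is unchanged because every
    output of \<open>M\<close> lies in that range.\<close>
  define S' where "S' = mechanism_range P M \<inter> (\<phi> -` B)"
  have "\<phi> -` B \<in> sets borel"
    using measurable_sets[OF \<phi> B(1)] by simp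
  then have S': "S' \<in> sets (restrict_space borel (mechanism_range P M))"
    by (auto simp: S'_def sets_restrict_space)
  have "{w \<in> space P. N D w \<in> S} = {w \<in> space P. M D w \<in> S'}" for D
    using N by (auto simp: B(2) S'_def mechanism_range_def)
  then show "measure P {w \<in> space P. N D1 w \<in> S}
      \<le> exp \<epsilon> * measure P {w \<in> space P. N D2 w \<in> S} + \<delta>"
    using dp nb S' unfolding differentially_private_def by simp
qed

theorem theorem5p4:
  fixes K :: nat
    and \<pi> :: "nat \<Rightarrow> real"
    and \<mu> :: "nat \<Rightarrow> real^'n"
    and \<Sigma> :: "nat \<Rightarrow> real^'n^'n"
    and R :: "real^'n \<Rightarrow> real^'n^'n"
    and P :: "'w measure"
    and M :: "'s list \<Rightarrow> 'w \<Rightarrow> real^'n"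
    and \<epsilon> \<delta> :: real
    and x :: "'s list \<Rightarrow> 'w \<Rightarrow> real \<Rightarrow> real^'n"
  assumes mixture: "mog_parameters K \<pi> \<mu> \<Sigma>"
    and morse: "morse (\<lambda>y. - ln (mog K \<pi> \<mu> \<Sigma> y))"
    and metric: "riemannian_metric R"
    and condition: "bdd_above (range (\<lambda>y. condition_number (R y)))"
    and complete: "\<forall>x0. \<exists>y. is_trajectory (mog_field R K \<pi> \<mu> \<Sigma>) y \<and> y 0 = x0"
    and dp: "differentially_private P M \<epsilon> \<delta>"
    and trajectory: "\<forall>D. \<forall>w \<in> space P.
          is_trajectory (mog_field R K \<pi> \<mu> \<Sigma>) (x D w) \<and> x D w 0 = M D w"
  shows "\<forall>t::real. differentially_private P (\<lambda>D w. x D w t) \<epsilon> \<delta>"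
proof
  fix t :: real
  \<comment> \<open>One map serves all datasets and all outcomes, so evaluating the trajectory at
    \<open>t\<close> is a post-processing of \<open>M\<close> that does not look at the data
    again.\<close>
  obtain \<phi> where \<phi>: "continuous_on UNIV \<phi>"
    "\<And>y. is_trajectory (mog_field R K \<pi> \<mu> \<Sigma>) y \<Longrightarrow> y t = \<phi> (y 0)"
    using continuous_time_map[OF ball_lipschitz_mog_field[OF mixture metric]] complete by blast
  show "differentially_private P (\<lambda>D w. x D w t) \<epsilon> \<delta>"
  proof (rule differentially_private_postprocess[OF dp])
    show "\<phi> \<in> borel_measurable borel"
      using \<phi>(1) by (rule borel_measurable_continuous_onI)
    show "x D w t = \<phi> (M D w)" if "w \<in> space P" for D w
      using \<phi>(2)[of "x D w"] trajectory that by simp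
  qed
qed

end
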